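(* There exist a smooth bounded toroidal domain $\Omega\subset\mathbb{R}^3$, a constant $P_b\in\mathbb{R}$, a vector field $\boldsymbol{u}\in C^\infty(\Omega)$ and a function $P\in C^\infty(\Omega)$ such that $$(\nabla\times\boldsymbol{u})\times\boldsymbol{u}=\nabla P\quad\text{in }\Omega,\qquad \boldsymbol{u}\cdot\boldsymbol{n}=0,\quad P=P_b\quad\text{on }\partial\Omega,$$ where $\boldsymbol{n}$ is the unit outward normal to $\partial\Omega$, and such that (i) $\nabla\times\boldsymbol{u}$ and $\boldsymbol{u}$ are not everywhere collinear in $\Omega$, and (ii) the level sets of $P$ are not invariant under continuous Euclidean isometries.
   Context: A smooth bounded toroidal domain (toroidal volume) is a bounded open set $\Omega\subset\mathbb{R}^3$ with smooth boundary whose closure is diffeomorphic to a closed solid torus $\overline{D^2}\times S^1$. The fields $\boldsymbol{u}$ and $P$ are understood to extend continuously to $\overline\Omega$, so that the boundary conditions make sense. The generators of continuous Euclidean isometries of $\mathbb{R}^3$ are the vector fields $\boldsymbol{\xi}_E(\boldsymbol{x})=\boldsymbol{a}+\boldsymbol{b}\times\boldsymbol{x}$ with constant $\boldsymbol{a},\boldsymbol{b}\in\mathbb{R}^3$. The level sets of a function $P$ on $\Omega$ are not invariant under continuous Euclidean isometries if, for every $\boldsymbol{\xi}_E=\boldsymbol{a}+\boldsymbol{b}\times\boldsymbol{x}$ with $(\boldsymbol{a},\boldsymbol{b})\neq(\boldsymbol{0},\boldsymbol{0})$, the Lie derivative $\mathfrak{L}_{\boldsymbol{\xi}_E}P=\boldsymbol{\xi}_E\cdot\nabla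 P$ is not identically zero in $\Omega$. *)

theory Defs
  imports "HOL-Analysis.Analysis"
begin

text \<open>
  Smoothness.  On an open set, \<open>Ck_on k f S\<close> is the usual class \<open>C\<^sup>k\<close>.  On an arbitrary
  set \<open>smooth_map_on\<close> is smoothness in the sense of local smooth extensions, which for embedded
  submanifolds, possibly with boundary, agrees with smoothness in charts.
\<close>

primrec Ck_on ::
  "nat \<Rightarrow> ('a::euclidean_space \<Rightarrow> 'b::real_normed_vector) \<Rightarrow> 'a set \<Rightarrow> bool" where
  "Ck_on 0 f S \<longleftrightarrow> continuous_on S f"
| "Ck_on (Suc k) f S \<longleftrightarrow> (\<forall>x\<in>S. f differentiable (at x)) \<and>
     (\<forall>v. Ck_on k (\<lambda>x. frechet_derivative f (at x) v) S)"

definition Cinf_on ::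
  "('a::euclidean_space \<Rightarrow> 'b::real_normed_vector) \<Rightarrow> 'a set \<Rightarrow> bool" where
  "Cinf_on f S \<longleftrightarrow> (\<forall>k. Ck_on k f S)"

definition smooth_map_on ::
  "('a::euclidean_space \<Rightarrow> 'b::real_normed_vector) \<Rightarrow> 'a set \<Rightarrow> bool" where
  "smooth_map_on f S \<longleftrightarrow>
     (\<forall>x\<in>S. \<exists>U F. open U \<and> x \<in> U \<and> Cinf_on F U \<and> (\<forall>y\<in>U \<inter> S. F y = f y))"

definition diffeomorphic ::
  "'a::euclidean_space set \<Rightarrow> 'b::euclidean_space set \<Rightarrow> bool" where
  "diffeomorphic S T \<longleftrightarrow>
     (\<exists>f g. homeomorphism S T f g \<and> smooth_map_on f S \<and> smooth_map_on g T)"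

definition grad :: "(real^3 \<Rightarrow> real) \<Rightarrow> real^3 \<Rightarrow> real^3" where
  "grad f x = (\<chi> i. frechet_derivative f (at x) (axis i 1))"

definition partial_deriv :: "3 \<Rightarrow> (real^3 \<Rightarrow> real^3) \<Rightarrow> 3 \<Rightarrow> real^3 \<Rightarrow> real" where
  "partial_deriv j u i x = frechet_derivative u (at x) (axis j 1) $ i"

definition curl :: "(real^3 \<Rightarrow> real^3) \<Rightarrow> real^3 \<Rightarrow> real^3" where
  "curl u x = vector
     [partial_deriv 2 u 3 x - partial_deriv 3 u 2 x,
      partial_deriv 3 u 1 x - partial_deriv 1 u 3 x,
      partial_deriv 1 u 2 x - partial_deriv 2 u 1 x]"

text \<open>
  A local defining function at a boundary point \<open>p\<close>: it is negative exactly on the part of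
  \<open>\<Omega>\<close> in \<open>U\<close>.  As its gradient does not vanish, its zero set in \<open>U\<close> is
  the boundary of \<open>\<Omega>\<close> in \<open>U\<close>, and the gradient points out of \<open>\<Omega>\<close> there.
\<close>

definition boundary_defining_function ::
  "(real^3) set \<Rightarrow> real^3 \<Rightarrow> (real^3) set \<Rightarrow> (real^3 \<Rightarrow> real) \<Rightarrow> bool" where
  "boundary_defining_function \<Omega> p U \<rho> \<longleftrightarrow>
     open U \<and> p \<in> U \<and> Cinf_on \<rho> U \<and> (\<forall>x\<in>U. grad \<rho> x \<noteq> 0) \<and>
     \<Omega> \<inter> U = {x\<in>U. \<rho> x < 0}"

definition smooth_boundary :: "(real^3) set \<Rightarrow> bool" where
  "smooth_boundary \<Omega> \<longleftrightarrow> (\<forall>p\<in>frontier \<Omega>. \<exists>U \<rho>. boundary_defining_function \<Omega> p U \<rho>)"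

text \<open>
  When the boundary is smooth, each boundary point has exactly one unit outward normal; it does
  not depend on the defining function.
\<close>

definition unit_outward_normal :: "(real^3) set \<Rightarrow> real^3 \<Rightarrow> real^3 \<Rightarrow> bool" where
  "unit_outward_normal \<Omega> p n \<longleftrightarrow> p \<in> frontier \<Omega> \<and>
     (\<exists>U \<rho>. boundary_defining_function \<Omega> p U \<rho> \<and> n = sgn (grad \<rho> p))"

definition closed_solid_torus :: "(complex \<times> complex) set" where
  "closed_solid_torus = cball 0 1 \<times> sphere 0 1"

definition smooth_bounded_toroidal_domain :: "(real^3) set \<Rightarrow> bool" where
  "smooth_bounded_toroidal_domain \<Omega> \<longleftrightarrow>
     bounded \<Omega> \<and> open \<Omega> \<and> smooth_boundary \<Omega> \<and>
     diffeomorphic (closure \<Omega>) closed_solid_torus"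

definition euclidean_generator :: "real^3 \<Rightarrow> real^3 \<Rightarrow> real^3 \<Rightarrow> real^3" where
  "euclidean_generator a b x = a + cross3 b x"

definition lie_derivative ::
  "(real^3 \<Rightarrow> real^3) \<Rightarrow> (real^3 \<Rightarrow> real) \<Rightarrow> real^3 \<Rightarrow> real" where
  "lie_derivative \<xi> P x = \<xi> x \<bullet> grad P x"

definition level_sets_not_euclidean_invariant ::
  "(real^3) set \<Rightarrow> (real^3 \<Rightarrow> real) \<Rightarrow> bool" where
  "level_sets_not_euclidean_invariant \<Omega> P \<longleftrightarrow>
     (\<forall>a b. (a, b) \<noteq> (0, 0) \<longrightarrow>
        \<not> (\<forall>x\<in>\<Omega>. lie_derivative (euclidean_generator a b) P x = 0))"

end

theory Submission
  imports Defs "HOL-Computational_Algebra.Polynomial"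
begin

text \<open>
  The velocity is not required to be divergence free, so compactly supported solutions exist.
  Let \<open>s\<close> be the squared distance to a circle and \<open>\<theta>\<close> the angle around it in the meridian plane.
  As \<open>\<nabla>\<theta> \<bullet> \<nabla>s = 0\<close> and \<open>\<bar>\<nabla>\<theta>\<bar>\<^sup>2 = 1 / s\<close>, every field \<open>u = g(s) \<nabla>\<theta>\<close> satisfies
  \<open>curl u \<times> u = - (g g' / s) \<nabla>s\<close>, which is the gradient of a function of \<open>s\<close>.  With a smooth
  cutoff \<open>g\<close>, both \<open>u\<close> and the pressure are supported in a thin tube around the circle, and only
  rotations about the axis of the circle leave this pressure invariant.  Two copies with disjoint
  supports and different axes, placed inside one large solid torus, leave no common isometry.
\<close>

section \<open>Calculus of smooth functions\<close>

lemma Ck_on_cong: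
  assumes "open S" "\<And>x. x \<in> S \<Longrightarrow> f x = g x" "Ck_on k f S"
  shows "Ck_on k g S"
  using assms(2,3)
proof (induction k arbitrary: f g)
  case 0
  then show ?case by (simp cong: continuous_on_cong)
next
  case (Suc k)
  have der: "(f has_derivative f') (at x) \<longleftrightarrow> (g has_derivative f') (at x)" if "x \<in> S" for x f'
    using has_derivative_transform_within_open[OF _ \<open>open S\<close> that, of f f' UNIV g]
      has_derivative_transform_within_open[OF _ \<open>open S\<close> that, of g f' UNIV f] Suc.prems(1)
    by auto
  have fd: "frechet_derivative f (at x) = frechet_derivative g (at x)" if "x \<in> S" for x
    unfolding frechet_derivative_def der[OF that] ..
  have "Ck_on k (\<lambda>x. frechet_derivative g (at x) v) S" for v
    by (rule Suc.IH[of "\<lambda>x. frechet_derivative f (at x) v"]) (use Suc.prems(2) fd in auto)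
  then show ?case
    using Suc.prems(2) der by (auto simp: differentiable_def)
qed

text \<open>Lets a derivative computed by hand stand in for \<open>frechet_derivative\<close>;
  uniqueness of derivatives identifies the two on the open set \<open>S\<close>.\<close>

lemma Ck_on_SucI:
  assumes "open S" "\<And>x. x \<in> S \<Longrightarrow> (f has_derivative f' x) (at x)"
    and "\<And>v. Ck_on k (\<lambda>x. f' x v) S"
  shows "Ck_on (Suc k) f S"
proof -
  have "Ck_on k (\<lambda>x. frechet_derivative f (at x) v) S" for v
    by (rule Ck_on_cong[OF assms(1) _ assms(3)[of v]])
      (metis assms(2) frechet_derivative_at)
  then show ?thesis
    using assms(2) by (auto simp: differentiable_def)
qed

lemma Ck_on_SucD:
  assumes "Ck_on (Suc k) f S"
  shows "Ck_on k f S"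
  using assms
proof (induction k arbitrary: f)
  case 0
  then show ?case
    by (simp add: continuous_at_imp_continuous_on differentiable_imp_continuous_within)
next
  case (Suc k)
  then show ?case by auto
qed

lemma Ck_on_subset:
  assumes "Ck_on k f S" "T \<subseteq> S"
  shows "Ck_on k f T"
  using assms by (induction k arbitrary: f) (auto intro: continuous_on_subset)

lemma Ck_on_Un:
  assumes "open S" "open T" "Ck_on k f S" "Ck_on k f T"
  shows "Ck_on k f (S \<union> T)"
  using assms(3,4)
  by (induction k arbitrary: f) (auto intro: continuous_on_open_Un assms(1,2))

lemma Ck_on_const: "Ck_on k (\<lambda>x. c) S"
  by (induction k arbitrary: c) (auto simp: frechet_derivative_const)

lemma Ck_on_bounded_linear:
  assumes "bounded_linear f" "open S"
  shows "Ck_on k f S"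
proof (cases k)
  case 0
  then show ?thesis using assms by (simp add: linear_continuous_on)
next
  case (Suc m)
  then show ?thesis
    using Ck_on_SucI[OF assms(2) bounded_linear_imp_has_derivative[OF assms(1)] Ck_on_const]
    by simp
qed

lemma Ck_on_has_derivative:
  assumes "Ck_on (Suc k) f S" "x \<in> S"
  shows "(f has_derivative frechet_derivative f (at x)) (at x)"
  using assms by (simp add: frechet_derivative_works)

lemma Ck_on_add:
  assumes "open S" "Ck_on k f S" "Ck_on k g S"
  shows "Ck_on k (\<lambda>x. f x + g x) S"
  using assms(2,3)
proof (induction k arbitrary: f g)
  case 0
  then show ?case by (simp add: continuous_on_add)
next
  case (Suc k)
  show ?case
    by (rule Ck_on_SucI[OF assms(1) has_derivative_add[OF
          Ck_on_has_derivative[OF Suc.prems(1)] Ck_on_has_derivative[OF Suc.prems(2)]]])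
      (use Suc in auto)
qed

lemma Ck_on_scaleR:
  fixes f :: "'a::euclidean_space \<Rightarrow> real"
  assumes "open S" "Ck_on k f S" "Ck_on k g S"
  shows "Ck_on k (\<lambda>x. f x *\<^sub>R g x) S"
  using assms(2,3)
proof (induction k arbitrary: f g)
  case 0
  then show ?case by (simp add: continuous_on_scaleR)
next
  case (Suc k)
  show ?case
    by (rule Ck_on_SucI[OF assms(1) has_derivative_scaleR[OF
          Ck_on_has_derivative[OF Suc.prems(1)] Ck_on_has_derivative[OF Suc.prems(2)]]])
      (use Suc Ck_on_SucD[OF Suc.prems(1)] Ck_on_SucD[OF Suc.prems(2)] 
        in \<open>auto intro!: Ck_on_add assms(1)\<close>)
qed

lemma Ck_on_mult:
  fixes f g :: "'a::euclidean_space \<Rightarrow> real"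
  assumes "open S" "Ck_on k f S" "Ck_on k g S"
  shows "Ck_on k (\<lambda>x. f x * g x) S"
  using Ck_on_scaleR[OF assms] by simp

lemma Ck_on_translation:
  assumes "Ck_on k f UNIV"
  shows "Ck_on k (\<lambda>x. f (x + c)) UNIV"
  using assms
proof (induction k arbitrary: f)
  case 0
  then have "continuous_on UNIV f" by simp
  then have "continuous_on UNIV (\<lambda>x. f (x + c))"
    by (rule continuous_on_compose2) (auto intro: continuous_intros)
  then show ?case by simp
next
  case (Suc k)
  have "((\<lambda>x. f (x + c)) has_derivative frechet_derivative f (at (x + c))) (at x)" for x
    by (rule has_derivative_compose[of "\<lambda>x. x + c" "\<lambda>v. v"])
      (use Ck_on_has_derivative[OF Suc.prems] in \<open>auto intro!: derivative_eq_intros\<close>)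
  then show ?case
    by (rule Ck_on_SucI[OF open_UNIV]) (use Suc in auto)
qed

lemma Ck_on_inverse:
  fixes f :: "'a::euclidean_space \<Rightarrow> real"
  assumes "open S" "Ck_on k f S" "\<And>x. x \<in> S \<Longrightarrow> f x \<noteq> 0"
  shows "Ck_on k (\<lambda>x. inverse (f x)) S"
  using assms(2)
proof (induction k)
  case 0
  then show ?case using assms(3) by (simp add: continuous_on_inverse)
next
  case (Suc k)
  \<comment> \<open>The derivative is arranged as nested products so that \<open>Ck_on_mult\<close>
    applies; the factors \<open>inverse (f x)\<close> are covered by the induction
    hypothesis.\<close>
  have "((\<lambda>x. inverse (f x)) has_derivative
      (\<lambda>v. (- 1) * (inverse (f x) * (inverse (f x) * frechet_derivative f (at x) v)))) (at x)"
    if "x \<in> S" for x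
    using Deriv.has_derivative_inverse[OF assms(3)[OF that] Ck_on_has_derivative[OF Suc.prems that]]
    by (simp add: mult_ac)
  note der = this
  show ?case
    by (intro Ck_on_SucI[OF assms(1) der] Ck_on_mult Ck_on_const assms(1))
      (use Suc Ck_on_SucD[OF Suc.prems] in auto)
qed

lemma Ck_on_sqrt:
  fixes f :: "'a::euclidean_space \<Rightarrow> real"
  assumes "open S" "Ck_on k f S" "\<And>x. x \<in> S \<Longrightarrow> 0 < f x"
  shows "Ck_on k (\<lambda>x. sqrt (f x)) S"
  using assms(2)
proof (induction k)
  case 0
  then show ?case by (simp add: continuous_on_real_sqrt)
next
  case (Suc k)
  have "((\<lambda>x. sqrt (f x)) has_derivative
      (\<lambda>v. (1/2) * (inverse (sqrt (f x)) * frechet_derivative f (at x) v))) (at x)"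
    if "x \<in> S" for x
    using has_derivative_real_sqrt[OF assms(3)[OF that] Ck_on_has_derivative[OF Suc.prems that]]
    by (simp add: field_simps)
  note der = this
  have "Ck_on k (\<lambda>x. inverse (sqrt (f x))) S"
    by (rule Ck_on_inverse[OF assms(1) Suc.IH[OF Ck_on_SucD[OF Suc.prems]]])
      (use assms(3) in force)
  then show ?case
    by (intro Ck_on_SucI[OF assms(1) der] Ck_on_mult Ck_on_const assms(1)) (use Suc in auto)
qed

section \<open>Flat functions\<close>

text \<open>
  Derivatives of \<open>exp (- 1 / t)\<close> are polynomials in \<open>1 / t\<close> times \<open>exp (- 1 / t)\<close>; carrying the
  polynomial as a parameter makes the family closed under differentiation.
\<close>

definition flat :: "real poly \<Rightarrow> real \<Rightarrow> real" where
  "flat p t = (if t > 0 then poly p (1 / t) * exp (- (1 / t)) else 0)"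

text \<open>With \<open>s = 1 / t\<close>, so that \<open>ds/dt = - s^2\<close>, the chain rule
  turns \<open>poly p s * exp (- s)\<close> into
  \<open>s^2 * (p - p')(s) * exp (- s)\<close>.\<close>

definition flat_deriv :: "real poly \<Rightarrow> real poly" where
  "flat_deriv p = [:0, 0, 1:] * (p - pderiv p)"

lemma poly_times_exp_tendsto_0:
  fixes p :: "real poly"
  shows "((\<lambda>s. poly p s * exp (- s)) \<longlongrightarrow> 0) at_top"
proof -
  have "((\<lambda>s. \<Sum>i\<le>degree p. coeff p i * (s ^ i / exp s)) \<longlongrightarrow> (\<Sum>i\<le>degree p. coeff p i * 0)) at_top"
    by (intro tendsto_sum tendsto_mult tendsto_const tendsto_power_div_exp_0)
  then show ?thesis
    by (simp add: poly_altdef sum_distrib_right exp_minus divide_inverse sum_distrib_left mult_ac)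
qed

lemma flat_has_real_derivative:
  "(flat p has_real_derivative flat (flat_deriv p) t) (at t)"
proof -
  consider "t > 0" | "t < 0" | "t = 0" by linarith
  then show ?thesis
  proof cases
    case 1
    have "((\<lambda>t. poly p (1 / t) * exp (- (1 / t))) has_real_derivative
        flat (flat_deriv p) t) (at t)"
      using 1 by (auto intro!: derivative_eq_intros poly_DERIV DERIV_chain2[OF poly_DERIV]
          simp: flat_def flat_deriv_def field_simps power2_eq_square)
    then show ?thesis
      by (rule has_field_derivative_transform_within_open[of _ _ _ "{0<..}"])
        (use 1 in \<open>auto simp: flat_def\<close>)
  next
    case 2
    have "((\<lambda>t. 0) has_real_derivative flat (flat_deriv p) t) (at t)"
      using 2 by (simp add: flat_def)
    then show ?thesis
      by (rule has_field_derivative_transform_within_open[of _ _ _ "{..<0}"])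
        (use 2 in \<open>auto simp: flat_def\<close>)
  next
    case 3
    \<comment> \<open>For \<open>h > 0\<close> and \<open>s = inverse h\<close>, the difference
      quotient \<open>flat p h / h\<close> is \<open>s * poly p s * exp (- s)\<close>; the factor
      \<open>s\<close> is \<open>[:0, 1:]\<close>.\<close>
    have "((\<lambda>h. poly ([:0, 1:] * p) (inverse h) * exp (- inverse h)) \<longlongrightarrow> 0) (at_right 0)"
      by (rule filterlim_compose[OF poly_times_exp_tendsto_0 filterlim_inverse_at_top_right])
    then have "((\<lambda>h. flat p h / h) \<longlongrightarrow> 0) (at_right 0)"
      by (rule Lim_transform_eventually)
        (auto simp: eventually_at_filter flat_def field_simps)
    moreover have "((\<lambda>h. flat p h / h) \<longlongrightarrow> 0) (at_left 0)"
      by (rule Lim_transform_eventually[OF tendsto_const])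
        (auto simp: eventually_at_filter flat_def)
    ultimately have "((\<lambda>h. flat p h / h) \<longlongrightarrow> 0) (at 0)"
      by (simp add: filterlim_split_at)
    then show ?thesis
      using 3 by (simp add: DERIV_def flat_def)
  qed
qed

text \<open>Differentiation only replaces \<open>p\<close> by \<open>flat_deriv p\<close>, so the
  induction runs over all \<open>p\<close> at once while \<open>f\<close> stays fixed.\<close>

lemma Ck_on_flat:
  fixes f :: "'a::euclidean_space \<Rightarrow> real"
  assumes "open S" "Ck_on k f S"
  shows "Ck_on k (\<lambda>x. flat p (f x)) S"
  using assms(2)
proof (induction k arbitrary: p)
  case 0
  have "continuous_on UNIV (flat p)"
    using flat_has_real_derivative by (intro DERIV_continuous_on)
  with 0 have "continuous_on S (\<lambda>x. flat p (f x))"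
    by (auto intro: continuous_on_compose2)
  then show ?case by simp
next
  case (Suc k)
  have "((\<lambda>x. flat p (f x)) has_derivative
      (\<lambda>v. flat (flat_deriv p) (f x) * frechet_derivative f (at x) v)) (at x)" if "x \<in> S" for x
    using has_derivative_compose[OF Ck_on_has_derivative[OF Suc.prems that]
        flat_has_real_derivative[of p "f x", unfolded has_field_derivative_def]]
    by simp
  then show ?case
    by (rule Ck_on_SucI[OF assms(1)])
      (use Suc Ck_on_SucD[OF Suc.prems] in \<open>auto intro!: Ck_on_mult assms(1)\<close>)
qed

section \<open>Tubes around circles\<close>

lemma Ck_on_component: "open S \<Longrightarrow> Ck_on k (\<lambda>x::real^3. x $ i) S"
  by (rule Ck_on_bounded_linear[OF bounded_linear_vec_nth])

definition radius :: "real^3 \<Rightarrow> real" where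
  "radius x = sqrt ((x $ 1)\<^sup>2 + (x $ 2)\<^sup>2)"

text \<open>For \<open>R \<ge> 0\<close> this is the squared distance to the horizontal circle of
  radius \<open>R\<close> centred at the origin.\<close>

definition tube :: "real \<Rightarrow> real^3 \<Rightarrow> real" where
  "tube R x = (radius x - R)\<^sup>2 + (x $ 3)\<^sup>2"

lemma radius_nonneg [simp]: "0 \<le> radius x"
  by (simp add: radius_def)

lemma radius_power2: "(radius x)\<^sup>2 = (x $ 1)\<^sup>2 + (x $ 2)\<^sup>2"
  by (simp add: radius_def)

lemma radius_pos_iff: "0 < radius x \<longleftrightarrow> x $ 1 \<noteq> 0 \<or> x $ 2 \<noteq> 0"
  by (simp add: radius_def sum_power2_gt_zero_iff)

lemma continuous_on_radius: "continuous_on S radius"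
  unfolding radius_def by (intro continuous_intros)

lemma continuous_on_tube: "continuous_on S (tube R)"
  unfolding tube_def by (intro continuous_intros continuous_on_radius)

lemma open_radius_pos: "open {x. 0 < radius x}"
  by (intro open_Collect_less continuous_on_const continuous_on_radius)

lemma Ck_on_radius: "open S \<Longrightarrow> S \<subseteq> {x. 0 < radius x} \<Longrightarrow> Ck_on k radius S"
  unfolding radius_def power2_eq_square
  by (intro Ck_on_sqrt Ck_on_add Ck_on_mult Ck_on_component)
    (auto simp: radius_def power2_eq_square)

lemma Ck_on_tube: "open S \<Longrightarrow> S \<subseteq> {x. 0 < radius x} \<Longrightarrow> Ck_on k (tube R) S"
  unfolding tube_def power2_eq_square diff_conv_add_uminus
  by (intro Ck_on_add Ck_on_mult Ck_on_component Ck_on_radius Ck_on_const)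

lemma has_derivative_component: "((\<lambda>x::real^3. x $ i) has_derivative (\<lambda>v. v $ i)) (at x)"
  by (rule bounded_linear_imp_has_derivative[OF bounded_linear_vec_nth])

lemma has_derivative_radius:
  assumes "0 < radius x"
  shows "(radius has_derivative (\<lambda>v. (x $ 1 / radius x) * v $ 1 + (x $ 2 / radius x) * v $ 2)) (at x)"
proof -
  have pos: "0 < (x $ 1)\<^sup>2 + (x $ 2)\<^sup>2"
    using assms by (simp add: radius_def)
  have "((\<lambda>x::real^3. (x $ 1)\<^sup>2 + (x $ 2)\<^sup>2) has_derivative
      (\<lambda>v. 2 * (x $ 1 * v $ 1 + x $ 2 * v $ 2))) (at x)"
    by (auto intro!: derivative_eq_intros has_derivative_component simp: algebra_simps)
  from has_derivative_real_sqrt[OF pos this]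
  have "(radius has_derivative (\<lambda>v. 2 * (x $ 1 * v $ 1 + x $ 2 * v $ 2) * (inverse (radius x) / 2))) (at x)"
    by (simp add: radius_def[abs_def])
  then show ?thesis
    by (rule has_derivative_eq_rhs) (use assms in \<open>simp add: fun_eq_iff field_simps\<close>)
qed

lemma has_derivative_tube:
  assumes "0 < radius x"
  shows "(tube R has_derivative (\<lambda>v. 2 * ((radius x - R) *
      ((x $ 1 / radius x) * v $ 1 + (x $ 2 / radius x) * v $ 2) + x $ 3 * v $ 3))) (at x)"
proof -
  have "((\<lambda>x. radius x - R) has_derivative
      (\<lambda>v. (x $ 1 / radius x) * v $ 1 + (x $ 2 / radius x) * v $ 2)) (at x)"
    using has_derivative_diff[OF has_derivative_radius[OF assms] has_derivative_const[of R]] by simp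
  note r = has_derivative_mult[OF this this]
  note z = has_derivative_mult[OF has_derivative_component has_derivative_component]
  show ?thesis
    unfolding tube_def[abs_def] power2_eq_square
    by (rule has_derivative_eq_rhs[OF has_derivative_add[OF r z]]) (simp add: fun_eq_iff algebra_simps)
qed

section \<open>Gradient and curl from derivatives of components\<close>

lemma grad_eqI:
  assumes "(f has_derivative f') (at x)"
  shows "grad f x = vector [f' (axis 1 1), f' (axis 2 1), f' (axis 3 1)]"
  using frechet_derivative_at[OF assms] by (simp add: grad_def vec_eq_iff forall_3)

lemma curl_eqI:
  assumes "(f1 has_derivative f1') (at x)" "(f2 has_derivative f2') (at x)"
    "(f3 has_derivative f3') (at x)"
  shows "curl (\<lambda>x. f1 x *\<^sub>R axis 1 1 + f2 x *\<^sub>R axis 2 1 + f3 x *\<^sub>R axis 3 1) x =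
    vector [f3' (axis 2 1) - f2' (axis 3 1), f1' (axis 3 1) - f3' (axis 1 1),
      f2' (axis 1 1) - f1' (axis 2 1)]"
proof -
  have "((\<lambda>x. f1 x *\<^sub>R axis 1 1 + f2 x *\<^sub>R axis 2 1 + f3 x *\<^sub>R axis 3 1) has_derivative
      (\<lambda>v. f1' v *\<^sub>R axis 1 1 + f2' v *\<^sub>R axis 2 1 + f3' v *\<^sub>R (axis 3 1 :: real^3))) (at x)"
    by (intro has_derivative_add has_derivative_scaleR_left assms)
  from frechet_derivative_at[OF this, symmetric] show ?thesis
    by (simp add: curl_def partial_deriv_def axis_def)
qed

text \<open>Both sides admit exactly the same derivatives, so the choice behind
  \<open>frechet_derivative\<close> picks the same one. With \<open>c = 0\<close> this expresses
  locality; with \<open>c\<close> a centre it transfers derivatives to a translated copy.\<close>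

lemma frechet_derivative_shift_open:
  assumes "open S" "x \<in> S" "\<And>y. y \<in> S \<Longrightarrow> f y = g (y + c)"
  shows "frechet_derivative f (at x) = frechet_derivative g (at (x + c))"
proof -
  have "(f has_derivative f') (at x) \<longleftrightarrow> (g has_derivative f') (at (x + c))" for f'
  proof
    assume f: "(f has_derivative f') (at x)"
    have "((\<lambda>y. f (y - c)) has_derivative f') (at (x + c))"
      by (rule has_derivative_compose[of "\<lambda>y. y - c" "\<lambda>v. v"])
        (use f in \<open>auto intro!: derivative_eq_intros\<close>)
    then show "(g has_derivative f') (at (x + c))"
      by (rule has_derivative_transform_within_open[OF _ open_translation[OF assms(1), of c]])
        (use assms in \<open>auto simp: add.commute\<close>)
  next
    assume g: "(g has_derivative f') (at (x + c))"
    have "((\<lambda>y. g (y + c)) has_derivative f') (at x)"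
      by (rule has_derivative_compose[of "\<lambda>y. y + c" "\<lambda>v. v"])
        (use g in \<open>auto intro!: derivative_eq_intros\<close>)
    then show "(f has_derivative f') (at x)"
      by (rule has_derivative_transform_within_open[OF _ assms(1,2)]) (simp add: assms(3))
  qed
  then show ?thesis by (simp add: frechet_derivative_def)
qed

section \<open>A compactly supported solution\<close>

text \<open>
  With \<open>s = tube 1 x\<close> and \<open>\<theta>\<close> the angle around the unit circle in the plane of
  \<open>radius x - 1\<close> and \<open>x $ 3\<close>, this is \<open>h s \<nabla>\<theta>\<close>.  The profile
  \<open>h = exp (- 1 / t) / t\<close>, \<open>t = 1/4 - s\<close>, is chosen so that \<open>h\<^sup>2\<close>, the integrand of the
  pressure, has the elementary primitive \<open>exp (- 2 / t) / 2\<close>.  The division by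
  \<open>radius x = 0\<close> on the axis is harmless, since \<open>h\<close> vanishes near it.
\<close>

definition swirl :: "real^3 \<Rightarrow> real^3" where
  "swirl x = (let h = flat [:0, 1:] (1/4 - tube 1 x) in
     (h * (- (x $ 3 * (x $ 1 / radius x)))) *\<^sub>R axis 1 1 +
     (h * (- (x $ 3 * (x $ 2 / radius x)))) *\<^sub>R axis 2 1 +
     (h * (radius x - 1)) *\<^sub>R axis 3 1)"

text \<open>With \<open>u = h s \<nabla>\<theta>\<close>, the slope in \<open>s\<close> must be
  \<open>- h (s h)' = - h^2 / 2 - (s h^2 / 2)'\<close>. The first term integrates to
  \<open>exp (- 2 / t) / 4\<close>, since \<open>t\<close> decreases in \<open>s\<close>.\<close>

definition pressure :: "real^3 \<Rightarrow> real" where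
  "pressure x = (flat 1 (1/4 - tube 1 x))\<^sup>2 / 4 - tube 1 x * (flat [:0, 1:] (1/4 - tube 1 x))\<^sup>2 / 2"

definition outside :: "(real^3) set" where
  "outside = {x. 1/4 < tube 1 x}"

lemma open_outside: "open outside"
  unfolding outside_def by (intro open_Collect_less continuous_on_const continuous_on_tube)

lemma swirl_outside: "x \<in> outside \<Longrightarrow> swirl x = 0"
  by (simp add: outside_def swirl_def flat_def)

lemma pressure_outside: "x \<in> outside \<Longrightarrow> pressure x = 0"
  by (simp add: outside_def pressure_def flat_def)

lemma radius_pos_Un_outside: "{x. 0 < radius x} \<union> outside = UNIV"
proof -
  have "x \<in> outside" if "\<not> 0 < radius x" for x
  proof -
    have "radius x = 0" using that radius_nonneg[of x] by linarith
    then show ?thesis by (simp add: outside_def tube_def add_pos_nonneg)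
  qed
  then show ?thesis by auto
qed

text \<open>\<open>radius\<close> fails to be smooth on the axis, but axis points have squared
  distance at least 1 from the unit circle and so lie in \<open>outside\<close>. Smoothness is glued
  from two open sets covering space.\<close>

lemma Ck_on_UNIV_if_zero_outside:
  assumes "Ck_on k f {x. 0 < radius x}" "\<And>x. x \<in> outside \<Longrightarrow> f x = 0"
  shows "Ck_on k f UNIV"
proof -
  have "Ck_on k f outside"
    by (rule Ck_on_cong[OF open_outside _ Ck_on_const[of k 0]]) (simp add: assms(2))
  from Ck_on_Un[OF open_radius_pos open_outside assms(1) this] show ?thesis
    by (simp add: radius_pos_Un_outside)
qed

lemma Ck_on_flat_tube: "Ck_on k (\<lambda>x. flat p (1/4 - tube 1 x)) {x. 0 < radius x}"
proof -
  have "Ck_on k (\<lambda>x. 1/4 + (- 1) * tube 1 x) {x. 0 < radius x}"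
    by (intro Ck_on_add Ck_on_mult Ck_on_const Ck_on_tube open_radius_pos subset_refl)
  from Ck_on_flat[OF open_radius_pos this] show ?thesis by simp
qed

lemma Ck_on_swirl: "Ck_on k swirl UNIV"
proof (rule Ck_on_UNIV_if_zero_outside[OF _ swirl_outside])
  \<comment> \<open>Quotients, negations and differences become \<open>inverse\<close>, products and
    sums, for which the closure rules of \<open>Ck_on\<close> are stated.\<close>
  have eq: "swirl = (\<lambda>x. let h = flat [:0, 1:] (1/4 - tube 1 x) in
     (h * ((-1) * (x $ 3 * (x $ 1 * inverse (radius x))))) *\<^sub>R axis 1 1 +
     (h * ((-1) * (x $ 3 * (x $ 2 * inverse (radius x))))) *\<^sub>R axis 2 1 +
     (h * (radius x + (-1))) *\<^sub>R axis 3 1)"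
    by (simp add: swirl_def fun_eq_iff divide_inverse[of _ "radius x" for x])
  show "Ck_on k swirl {x. 0 < radius x}"
    unfolding eq Let_def
    by (intro Ck_on_add Ck_on_scaleR Ck_on_mult Ck_on_const Ck_on_component Ck_on_radius
        Ck_on_inverse open_radius_pos Ck_on_flat_tube subset_refl) simp_all
qed

lemma Ck_on_pressure: "Ck_on k pressure UNIV"
proof (rule Ck_on_UNIV_if_zero_outside[OF _ pressure_outside])
  have eq: "pressure = (\<lambda>x. (1/4) * (flat 1 (1/4 - tube 1 x) * flat 1 (1/4 - tube 1 x)) +
      (- 1/2) * (tube 1 x * (flat [:0, 1:] (1/4 - tube 1 x) * flat [:0, 1:] (1/4 - tube 1 x))))"
    by (simp add: pressure_def fun_eq_iff power2_eq_square)
  show "Ck_on k pressure {x. 0 < radius x}"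
    unfolding eq
    by (intro Ck_on_add Ck_on_mult Ck_on_const Ck_on_tube open_radius_pos Ck_on_flat_tube) auto
qed

text \<open>The derivative of the pressure as a function of \<open>s = tube 1 x\<close>.\<close>

definition pressure_slope :: "real \<Rightarrow> real" where
  "pressure_slope s = flat [:0, 1:] (1/4 - s) *
     (s * flat (flat_deriv [:0, 1:]) (1/4 - s) - flat [:0, 1:] (1/4 - s))"

lemma grad_pressure:
  assumes "0 < radius x"
  shows "grad pressure x = (2 * pressure_slope (tube 1 x)) *\<^sub>R
    vector [(radius x - 1) * (x $ 1 / radius x), (radius x - 1) * (x $ 2 / radius x), x $ 3]"
proof -
  let ?t = "1/4 - tube 1 x"
  define h where "h = flat [:0, 1:] ?t"
  define g where "g = flat (flat_deriv [:0, 1:]) ?t"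
  define e where "e = flat 1 ?t"
  define e' where "e' = flat (flat_deriv 1) ?t"
  \<comment> \<open>For \<open>t > 0\<close>, \<open>e = exp (- 1 / t)\<close> and
    \<open>e' = exp (- 1 / t) / t^2\<close>; otherwise both sides vanish. Thus
    \<open>e^2 / 4\<close> has derivative \<open>h^2 / 2\<close> in \<open>t\<close>.\<close>
  have ee: "e * e' = h\<^sup>2"
    by (simp add: e_def e'_def h_def flat_def flat_deriv_def power2_eq_square one_pCons pderiv_pCons)
  define dt where "dt = (\<lambda>v::real^3. 2 * ((radius x - 1) *
      ((x $ 1 / radius x) * v $ 1 + (x $ 2 / radius x) * v $ 2) + x $ 3 * v $ 3))"
  have T: "(tube 1 has_derivative dt) (at x)"
    using has_derivative_tube[OF assms] by (simp add: dt_def)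
  have F: "((\<lambda>x. flat p (1/4 - tube 1 x)) has_derivative
      (\<lambda>v. flat (flat_deriv p) ?t * (- dt v))) (at x)" for p
    using has_derivative_compose[OF has_derivative_diff[OF has_derivative_const[of "1/4"] T]
        flat_has_real_derivative[of p ?t, unfolded has_field_derivative_def]]
    by simp
  have "(pressure has_derivative (\<lambda>v. pressure_slope (tube 1 x) * dt v)) (at x)"
    unfolding pressure_def
    apply (rule derivative_eq_intros F T refl | simp)+
    apply (simp add: fun_eq_iff pressure_slope_def flip: h_def g_def e_def e'_def)
    using arg_cong[OF ee[symmetric], of "\<lambda>c. c * dt v" for v]
    by (simp add: field_simps power2_eq_square)
  from grad_eqI[OF this] show ?thesis
    by (simp add: dt_def vec_eq_iff forall_3 axis_def)
qed

text \<open>On the support the curl is azimuthal, while \<open>swirl\<close> lies in the meridian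
  plane and is orthogonal to the gradient of \<open>s\<close>. Their cross product is therefore
  parallel to that gradient, with factor \<open>- h * k\<close>, which is the slope of the
  pressure.\<close>

lemma swirl_equation:
  "cross3 (curl swirl x) (swirl x) = grad pressure x"
proof (cases "x \<in> outside")
  case True
  have "frechet_derivative pressure (at x) = frechet_derivative (\<lambda>x. 0) (at (x + 0))"
    by (rule frechet_derivative_shift_open[OF open_outside True pressure_outside])
  then have "grad pressure x = 0"
    by (simp add: grad_def vec_eq_iff)
  then show ?thesis using True by (simp add: swirl_outside)
next
  case False
  then have r: "0 < radius x" using radius_pos_Un_outside by auto
  let ?t = "1/4 - tube 1 x"
  define h where "h = flat [:0, 1:] ?t"
  define g where "g = flat (flat_deriv [:0, 1:]) ?t"
  define i where "i = 1 / radius x"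
  define X where "X = x $ 1 / radius x"
  define Y where "Y = x $ 2 / radius x"
  define z where "z = x $ 3"
  define q where "q = radius x - 1"
  \<comment> \<open>\<open>(X, Y)\<close> is the horizontal unit radial vector; its normalization
    enters the third component of the cross product.\<close>
  have "X\<^sup>2 + Y\<^sup>2 = (radius x)\<^sup>2 / (radius x)\<^sup>2"
    unfolding X_def Y_def power_divide add_divide_distrib[symmetric] radius_power2[of x, symmetric] ..
  then have XY: "X\<^sup>2 + Y\<^sup>2 = 1"
    using r by simp
  have tube: "tube 1 x = q\<^sup>2 + z\<^sup>2"
    by (simp add: tube_def q_def z_def)
  define dr where "dr = (\<lambda>v::real^3. X * v $ 1 + Y * v $ 2)"
  define dt where "dt = (\<lambda>v::real^3. 2 * (q * dr v + z * v $ 3))"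
  have R: "(radius has_derivative dr) (at x)"
    using has_derivative_radius[OF r] by (simp add: dr_def X_def Y_def)
  have T: "(tube 1 has_derivative dt) (at x)"
    using has_derivative_tube[OF r] by (simp add: dt_def dr_def q_def X_def Y_def z_def)
  have H: "((\<lambda>x. flat [:0, 1:] (1/4 - tube 1 x)) has_derivative (\<lambda>v. - (g * dt v))) (at x)"
    using has_derivative_compose[OF has_derivative_diff[OF has_derivative_const[of "1/4"] T]
        flat_has_real_derivative[of "[:0, 1:]" ?t, unfolded has_field_derivative_def]]
    by (simp add: g_def)
  have XD: "((\<lambda>x. x $ 1 / radius x) has_derivative (\<lambda>v. (v $ 1 - X * dr v) * i)) (at x)"
    using r by (intro has_derivative_eq_rhs[OF
          has_derivative_divide'[OF has_derivative_component R]])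
      (auto simp: X_def i_def field_simps)
  have YD: "((\<lambda>x. x $ 2 / radius x) has_derivative (\<lambda>v. (v $ 2 - Y * dr v) * i)) (at x)"
    using r by (intro has_derivative_eq_rhs[OF
          has_derivative_divide'[OF has_derivative_component R]])
      (auto simp: Y_def i_def field_simps)
  have Z: "((\<lambda>x::real^3. x $ 3) has_derivative (\<lambda>v. v $ 3)) (at x)"
    by (rule has_derivative_component)
  have Q: "((\<lambda>x. radius x - 1) has_derivative dr) (at x)"
    using has_derivative_diff[OF R has_derivative_const[of 1]] by simp
  \<comment> \<open>As \<open>g\<close> is the derivative of the profile in
    \<open>t = 1/4 - s\<close>, \<open>k\<close> is the derivative of \<open>s * h\<close> in
    \<open>s\<close>.\<close>
  define k where "k = h - g * (q\<^sup>2 + z\<^sup>2)"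
  have curl: "curl swirl x = vector [2 * Y * k, - 2 * X * k, 0]"
    unfolding swirl_def Let_def
    by (subst curl_eqI[OF
          has_derivative_mult[OF H has_derivative_minus[OF has_derivative_mult[OF Z XD]]]
          has_derivative_mult[OF H has_derivative_minus[OF has_derivative_mult[OF Z YD]]]
          has_derivative_mult[OF H Q]])
      (simp add: vec_eq_iff forall_3 axis_def dt_def dr_def k_def algebra_simps power2_eq_square
        flip: h_def X_def Y_def z_def q_def)
  have swirl: "swirl x = vector [- h * z * X, - h * z * Y, h * q]"
    by (simp add: swirl_def vec_eq_iff forall_3 axis_def flip: h_def X_def Y_def z_def q_def)
  have slope: "pressure_slope (tube 1 x) = - h * k"
    by (simp add: pressure_slope_def k_def flip: h_def g_def) (simp add: tube algebra_simps)
  have "Y * k * h * z * Y + X * k * h * z * X = k * h * z * (X\<^sup>2 + Y\<^sup>2)"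
    by (simp add: algebra_simps power2_eq_square)
  then have "Y * k * h * z * Y + X * k * h * z * X = k * h * z"
    by (simp add: XY)
  then show ?thesis
    unfolding curl swirl grad_pressure[OF r] slope
    by (simp add: vec_eq_iff forall_3 cross3_simps flip: X_def Y_def z_def q_def)
qed

section \<open>Extent of the support\<close>

lemma radius_eq_cmod: "radius x = cmod (Complex (x $ 1) (x $ 2))"
  by (simp add: radius_def cmod_def)

lemma abs_component_le_radius: "\<bar>x $ 1\<bar> \<le> radius x"
  using abs_Re_le_cmod[of "Complex (x $ 1) (x $ 2)"] by (simp add: radius_eq_cmod)

lemma tube_le_bounds:
  assumes "tube R x \<le> c\<^sup>2" "0 \<le> c"
  shows "\<bar>radius x - R\<bar> \<le> c" "\<bar>x $ 3\<bar> \<le> c"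
proof -
  have "(radius x - R)\<^sup>2 \<le> c\<^sup>2" "(x $ 3)\<^sup>2 \<le> c\<^sup>2"
    using assms(1) zero_le_power2[of "x $ 3"] zero_le_power2[of "radius x - R"]
    unfolding tube_def by linarith+
  then show "\<bar>radius x - R\<bar> \<le> c" "\<bar>x $ 3\<bar> \<le> c"
    using assms(2) by (simp_all flip: abs_le_square_iff)
qed

lemma not_outside_bounds:
  assumes "x \<notin> outside"
  shows "radius x \<le> 3/2" "\<bar>x $ 3\<bar> \<le> 1/2"
proof -
  have "tube 1 x \<le> (1/2)\<^sup>2"
    using assms by (simp add: outside_def power_divide)
  from tube_le_bounds[OF this] show "radius x \<le> 3/2" "\<bar>x $ 3\<bar> \<le> 1/2"
    by linarith+
qed

section \<open>The solid torus\<close>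

text \<open>Core radius 4 and tube radius 2 leave room for a copy of the support centred on the core
  circle: it extends at most 3/2 horizontally and 1/2 vertically, and 9/4 + 1/4 < 4.\<close>

definition solid :: "(real^3) set" where
  "solid = {x. tube 4 x < 4}"

text \<open>The first factor is the position in the cross-section disc, rescaled from radius 2 to 1;
  the second is the direction around the axis.\<close>

definition to_model :: "real^3 \<Rightarrow> complex \<times> complex" where
  "to_model x = (Complex ((radius x - 4) / 2) (x $ 3 / 2), Complex (x $ 1 / radius x) (x $ 2 / radius x))"

definition from_model :: "complex \<times> complex \<Rightarrow> real^3" where
  "from_model p = ((4 + 2 * Re (fst p)) * Re (snd p)) *\<^sub>R axis 1 1 +
     ((4 + 2 * Re (fst p)) * Im (snd p)) *\<^sub>R axis 2 1 + (2 * Im (fst p)) *\<^sub>R axis 3 1"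

lemma from_model_nth [simp]:
  "from_model p $ 1 = (4 + 2 * Re (fst p)) * Re (snd p)"
  "from_model p $ 2 = (4 + 2 * Re (fst p)) * Im (snd p)"
  "from_model p $ 3 = 2 * Im (fst p)"
  by (simp_all add: from_model_def axis_def)

lemma tube_le_radius_ge: "tube 4 x \<le> 4 \<Longrightarrow> 2 \<le> radius x"
  using tube_le_bounds(1)[of 4 x 2] by simp

lemma Ck_on_to_model: "Ck_on k to_model {x. 0 < radius x}"
proof -
  have eq: "to_model = (\<lambda>x. ((radius x + (- 4)) * (1/2)) *\<^sub>R (1, 0) + (x $ 3 * (1/2)) *\<^sub>R (\<i>, 0) +
      ((x $ 1 * inverse (radius x)) *\<^sub>R (0, 1) + (x $ 2 * inverse (radius x)) *\<^sub>R (0, \<i>)))"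
    by (simp add: fun_eq_iff to_model_def complex_eq_iff divide_inverse[of _ "radius x" for x])
  have "Ck_on k (\<lambda>x. inverse (radius x)) {x. 0 < radius x}"
    by (rule Ck_on_inverse[OF open_radius_pos Ck_on_radius[OF open_radius_pos subset_refl]]) simp
  then have "Ck_on k (\<lambda>x. (radius x + (- 4)) * (1/2)) {x. 0 < radius x}"
    "Ck_on k (\<lambda>x. x $ 3 * (1/2)) {x. 0 < radius x}"
    "Ck_on k (\<lambda>x. x $ i * inverse (radius x)) {x. 0 < radius x}" for i
    by (intro Ck_on_add Ck_on_mult Ck_on_const Ck_on_component Ck_on_radius
        open_radius_pos subset_refl; assumption)+
  then show ?thesis
    unfolding eq by (intro Ck_on_add[OF open_radius_pos] Ck_on_scaleR[OF open_radius_pos _ Ck_on_const])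
qed

lemma Ck_on_from_model: "Ck_on k from_model UNIV"
proof -
  have lin: "Ck_on k (\<lambda>p. L (M p)) UNIV" if "bounded_linear L" "bounded_linear M"
    for L :: "complex \<Rightarrow> real" and M :: "complex \<times> complex \<Rightarrow> complex"
    by (intro Ck_on_bounded_linear bounded_linear_compose[OF that] open_UNIV)
  have "Ck_on k (\<lambda>p. (4 + 2 * Re (fst p)) * Re (snd p)) (UNIV :: (complex \<times> complex) set)"
    "Ck_on k (\<lambda>p. (4 + 2 * Re (fst p)) * Im (snd p)) (UNIV :: (complex \<times> complex) set)"
    "Ck_on k (\<lambda>p. 2 * Im (fst p)) (UNIV :: (complex \<times> complex) set)"
    by (intro Ck_on_add Ck_on_mult Ck_on_const open_UNIV lin bounded_linear_Re bounded_linear_Im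
        bounded_linear_fst bounded_linear_snd)+
  then show ?thesis
    unfolding from_model_def by (intro Ck_on_add[OF open_UNIV] Ck_on_scaleR[OF open_UNIV _ Ck_on_const])
qed

text \<open>\<open>4 + 2 * Re (fst p)\<close> is at least 2 on the disc, so the square root recovers
  it from its square.\<close>

lemma radius_from_model:
  assumes "cmod (fst p) \<le> 1" "cmod (snd p) = 1"
  shows "radius (from_model p) = 4 + 2 * Re (fst p)"
proof -
  have "Re (fst p) \<ge> -1"
    using abs_Re_le_cmod[of "fst p"] assms(1) by linarith
  moreover have "(Re (snd p))\<^sup>2 + (Im (snd p))\<^sup>2 = 1"
    using assms(2) by (simp flip: cmod_power2)
  then have "((4 + 2 * Re (fst p)) * Re (snd p))\<^sup>2 + ((4 + 2 * Re (fst p)) * Im (snd p))\<^sup>2 =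
      (4 + 2 * Re (fst p))\<^sup>2"
    by (simp add: power_mult_distrib flip: distrib_left)
  ultimately show ?thesis
    by (simp add: radius_def)
qed

lemma tube_from_model:
  assumes "cmod (fst p) \<le> 1" "cmod (snd p) = 1"
  shows "tube 4 (from_model p) = 4 * (cmod (fst p))\<^sup>2"
  by (simp add: tube_def radius_from_model[OF assms] cmod_power2 power_mult_distrib)

lemma from_model_to_model:
  assumes "0 < radius x"
  shows "from_model (to_model x) = x"
proof -
  have "4 + 2 * ((radius x - 4) / 2) = radius x" by (simp add: field_simps)
  with assms show ?thesis by (simp add: vec_eq_iff forall_3 to_model_def)
qed

lemma to_model_from_model:
  assumes "cmod (fst p) \<le> 1" "cmod (snd p) = 1"
  shows "to_model (from_model p) = p"
proof -
  have "Re (fst p) \<ge> -1"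
    using abs_Re_le_cmod[of "fst p"] assms(1) by linarith
  then show ?thesis
    by (simp add: to_model_def radius_from_model[OF assms] complex_eq_iff prod_eq_iff)
qed

lemma to_model_in_model:
  assumes "tube 4 x \<le> 4"
  shows "to_model x \<in> closed_solid_torus"
proof -
  have r: "0 < radius x"
    using tube_le_radius_ge[OF assms] by linarith
  have "(cmod (fst (to_model x)))\<^sup>2 \<le> 1"
    using assms by (simp add: to_model_def cmod_power2 power_divide tube_def flip: add_divide_distrib)
  then have "cmod (fst (to_model x)) \<le> 1"
    by (simp add: power2_le_iff_abs_le abs_square_le_1)
  moreover have "snd (to_model x) = Complex (x $ 1) (x $ 2) / of_real (radius x)"
    by (simp add: to_model_def complex_eq_iff)
  then have "cmod (snd (to_model x)) = 1"
    using r by (simp add: norm_divide flip: radius_eq_cmod)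
  ultimately show ?thesis
    by (simp add: closed_solid_torus_def mem_Times_iff)
qed

lemma in_modelD:
  assumes "p \<in> closed_solid_torus"
  shows "cmod (fst p) \<le> 1" "cmod (snd p) = 1"
  using assms by (auto simp: closed_solid_torus_def mem_Times_iff)

text \<open>For the harder inclusion, a point of the closed tube is the image under
  \<open>from_model\<close> of a point in the closure of open disc times circle; that product is
  mapped into \<open>solid\<close>, and continuity passes to closures.\<close>

lemma closure_solid: "closure solid = {x. tube 4 x \<le> 4}"
proof
  have "closed {x. tube 4 x \<le> 4}"
    by (intro closed_Collect_le continuous_on_tube continuous_on_const)
  then show "closure solid \<subseteq> {x. tube 4 x \<le> 4}"
    by (rule closure_minimal[rotated]) (auto simp: solid_def)
next
  have "continuous_on UNIV from_model"
    using Ck_on_from_model[of 0] by simp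
  moreover have "from_model ` (ball 0 1 \<times> sphere 0 1) \<subseteq> closure solid"
  proof -
    have "from_model p \<in> solid" if "cmod (fst p) < 1" "cmod (snd p) = 1" for p
      using tube_from_model[of p] that by (simp add: solid_def abs_square_less_1)
    then show ?thesis using closure_subset by fastforce
  qed
  ultimately have "from_model ` closure (ball 0 1 \<times> sphere 0 1) \<subseteq> closure solid"
    by (intro image_closure_subset closed_closure) (auto intro: continuous_on_subset)
  then have *: "from_model ` closed_solid_torus \<subseteq> closure solid"
    by (simp add: closed_solid_torus_def closure_Times)
  show "{x. tube 4 x \<le> 4} \<subseteq> closure solid"
  proof clarify
    fix x assume x: "tube 4 x \<le> 4"
    have "0 < radius x" using tube_le_radius_ge[OF x] by linarith
    then show "x \<in> closure solid"
      using * to_model_in_model[OF x] from_model_to_model[of x] by force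
  qed
qed

lemma open_solid: "open solid"
  unfolding solid_def by (intro open_Collect_less continuous_on_tube continuous_on_const)

lemma frontier_solid: "x \<in> frontier solid \<Longrightarrow> tube 4 x = 4"
  using open_solid unfolding frontier_def closure_solid by (auto simp: interior_open) (simp add: solid_def)

lemma smooth_map_on_Ck:
  assumes "open U" "S \<subseteq> U" "\<And>k. Ck_on k f U"
  shows "smooth_map_on f S"
  unfolding smooth_map_on_def Cinf_on_def using assms by blast

lemma diffeomorphic_solid: "diffeomorphic (closure solid) closed_solid_torus"
proof -
  have sub: "closure solid \<subseteq> {x. 0 < radius x}"
    using tube_le_radius_ge by (force simp: closure_solid)
  have "homeomorphism (closure solid) closed_solid_torus to_model from_model"
  proof (rule homeomorphismI)
    show "continuous_on (closure solid) to_model"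
      using Ck_on_to_model[of 0] sub by (auto intro: continuous_on_subset)
    show "continuous_on closed_solid_torus from_model"
      using Ck_on_from_model[of 0] by (auto intro: continuous_on_subset)
    show "to_model ` closure solid \<subseteq> closed_solid_torus"
      using to_model_in_model by (auto simp: closure_solid)
    have "from_model p \<in> closure solid" if "p \<in> closed_solid_torus" for p
      using tube_from_model[OF in_modelD[OF that]] in_modelD(1)[OF that]
      by (simp add: closure_solid abs_square_le_1)
    then show "from_model ` closed_solid_torus \<subseteq> closure solid" by auto
  qed (use sub from_model_to_model to_model_from_model in_modelD in auto)
  moreover have "smooth_map_on to_model (closure solid)"
    by (rule smooth_map_on_Ck[OF open_radius_pos sub Ck_on_to_model])
  moreover have "smooth_map_on from_model closed_solid_torus"
    by (rule smooth_map_on_Ck[OF open_UNIV subset_UNIV Ck_on_from_model])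
  ultimately show ?thesis
    unfolding diffeomorphic_def by blast
qed

section \<open>Boundary and boundedness of the solid torus\<close>

lemma grad_tube:
  assumes "0 < radius x"
  shows "grad (tube R) x = 2 *\<^sub>R
    vector [(radius x - R) * (x $ 1 / radius x), (radius x - R) * (x $ 2 / radius x), x $ 3]"
  by (subst grad_eqI[OF has_derivative_tube[OF assms]]) (simp add: vec_eq_iff forall_3 axis_def)

lemma grad_tube_nonzero:
  assumes "0 < radius x" "0 < tube R x"
  shows "grad (tube R) x \<noteq> 0"
proof
  assume "grad (tube R) x = 0"
  then have *: "vector [(radius x - R) * (x $ 1 / radius x), (radius x - R) * (x $ 2 / radius x), x $ 3]
      = (0 :: real^3)"
    unfolding grad_tube[OF assms(1)] by simp
  have "(radius x - R) * (x $ 1 / radius x) = 0" "(radius x - R) * (x $ 2 / radius x) = 0" "x $ 3 = 0"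
    using arg_cong[OF *, of "\<lambda>v. v $ 1"] arg_cong[OF *, of "\<lambda>v. v $ 2"]
      arg_cong[OF *, of "\<lambda>v. v $ 3"] by simp_all
  then have "radius x = R" "x $ 3 = 0"
    using assms(1) radius_pos_iff[of x] by auto
  with assms(2) show False
    by (simp add: tube_def)
qed

lemma grad_add_const: "grad (\<lambda>x. f x + c) x = grad f x"
proof -
  have "((\<lambda>x. f x + c) has_derivative f') (at x) \<longleftrightarrow> (f has_derivative f') (at x)" for f'
    using has_derivative_add_const[of f f' "at x" c]
      has_derivative_add_const[of "\<lambda>x. f x + c" f' "at x" "- c"] by auto
  then show ?thesis by (simp add: grad_def frechet_derivative_def)
qed

lemma smooth_boundary_solid: "smooth_boundary solid"
  unfolding smooth_boundary_def
proof
  fix p assume "p \<in> frontier solid"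
  then have p: "tube 4 p = 4" by (rule frontier_solid)
  \<comment> \<open>Removed are the axis, where \<open>radius\<close> is not differentiable, and the
    core circle, where the gradient of \<open>tube 4\<close> vanishes.\<close>
  let ?U = "{x. 0 < radius x} \<inter> {x. 0 < tube 4 x}"
  have U: "open ?U"
    by (intro open_Int open_radius_pos open_Collect_less continuous_on_const continuous_on_tube)
  have "Cinf_on (\<lambda>x. tube 4 x + (- 4)) ?U"
    unfolding Cinf_on_def by (intro allI Ck_on_add Ck_on_const Ck_on_tube U) auto
  moreover have "p \<in> ?U"
    using p tube_le_radius_ge[of p] by auto
  ultimately have "boundary_defining_function solid p ?U (\<lambda>x. tube 4 x + (- 4))"
    unfolding boundary_defining_function_def
    using U grad_tube_nonzero unfolding grad_add_const by (auto simp: solid_def)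
  then show "\<exists>U \<rho>. boundary_defining_function solid p U \<rho>" by blast
qed

lemma bounded_solid: "bounded solid"
proof -
  have "norm x \<le> 8" if "x \<in> solid" for x
  proof -
    have "\<bar>radius x - 4\<bar> \<le> 2" "\<bar>x $ 3\<bar> \<le> 2"
      using that tube_le_bounds[of 4 x 2] by (simp_all add: solid_def)
    then have "(radius x)\<^sup>2 \<le> 6\<^sup>2" "\<bar>x $ 3\<bar>\<^sup>2 \<le> 2\<^sup>2"
      by (intro power_mono; simp)+
    moreover have "(norm x)\<^sup>2 = (radius x)\<^sup>2 + (x $ 3)\<^sup>2"
      unfolding power2_norm_eq_inner radius_power2 by (simp add: inner_vec_def sum_3 power2_eq_square)
    ultimately have "(norm x)\<^sup>2 \<le> 8\<^sup>2" by simp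
    then show ?thesis by (rule power2_le_imp_le) simp
  qed
  then show ?thesis by (auto simp: bounded_iff)
qed

lemma toroidal_solid: "smooth_bounded_toroidal_domain solid"
  by (simp add: smooth_bounded_toroidal_domain_def bounded_solid open_solid
      smooth_boundary_solid diffeomorphic_solid)

section \<open>Two solutions with different axes\<close>

text \<open>A point of the core circle of \<open>solid\<close>. The two copies sit around
  \<open>centre\<close> and \<open>- centre\<close>, so their rotation axes are distinct vertical
  lines.\<close>

definition centre :: "real^3" where "centre = axis 1 4"

lemma centre_nth [simp]: "centre $ 1 = 4" "centre $ 2 = 0" "centre $ 3 = 0"
  by (simp_all add: centre_def axis_def)

definition velocity :: "real^3 \<Rightarrow> real^3" where
  "velocity x = swirl (x + - centre) + swirl (x + centre)"

definition total_pressure :: "real^3 \<Rightarrow> real" where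
  "total_pressure x = pressure (x + - centre) + pressure (x + centre)"

lemma Ck_on_velocity: "Ck_on k velocity UNIV"
  unfolding velocity_def by (intro Ck_on_add Ck_on_translation Ck_on_swirl open_UNIV)

lemma Ck_on_total_pressure: "Ck_on k total_pressure UNIV"
  unfolding total_pressure_def by (intro Ck_on_add Ck_on_translation Ck_on_pressure open_UNIV)

text \<open>The reverse triangle inequality in the horizontal plane, where \<open>d\<close> has
  length 4, bounds the distance of \<open>radius (y + d)\<close> from 4 by
  \<open>radius y\<close>.\<close>

lemma tube_shift_less:
  assumes "y \<notin> outside" "d = centre \<or> d = - centre"
  shows "tube 4 (y + d) < 4"
proof -
  have "\<bar>radius (y + d) - 4\<bar> \<le> radius y"
    using norm_triangle_ineq3[of "Complex ((y + d) $ 1) ((y + d) $ 2)" "Complex (d $ 1) (d $ 2)"] assms(2)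
    by (auto simp: radius_eq_cmod complex_diff cmod_def[of "Complex 4 0"] cmod_def[of "Complex (-4) 0"])
  also have "\<dots> \<le> 3/2"
    by (rule not_outside_bounds(1)[OF assms(1)])
  finally have "\<bar>radius (y + d) - 4\<bar>\<^sup>2 \<le> (3/2)\<^sup>2"
    by (intro power_mono) auto
  moreover have "\<bar>(y + d) $ 3\<bar>\<^sup>2 \<le> (1/2)\<^sup>2"
    using not_outside_bounds(2)[OF assms(1)] assms(2) by (intro power_mono) auto
  ultimately show ?thesis
    by (simp add: tube_def power_divide)
qed

text \<open>Makes both copies vanish on the frontier of \<open>solid\<close>, which gives the
  boundary conditions.\<close>

lemma outside_if_tube_ge:
  assumes "4 \<le> tube 4 x"
  shows "x + - centre \<in> outside" "x + centre \<in> outside"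
  using tube_shift_less[of "x + - centre" centre] tube_shift_less[of "x + centre" "- centre"] assms
  by auto

lemma outside_if_far: "2 \<le> \<bar>x $ 1\<bar> \<Longrightarrow> x \<in> outside"
  using not_outside_bounds(1)[of x] abs_component_le_radius[of x] by linarith

text \<open>On the open half-space \<open>x $ 1 < 2\<close> the copy around \<open>centre\<close>
  vanishes, its argument having first coordinate below -2; the other half-space is symmetric. A
  single translated copy remains, together with its derivatives.\<close>

lemma shift_fields:
  assumes "d = centre \<and> x $ 1 < 2 \<or> d = - centre \<and> - 2 < x $ 1"
  shows "velocity x = swirl (x + d)" "total_pressure x = pressure (x + d)"
    "curl velocity x = curl swirl (x + d)" "grad total_pressure x = grad pressure (x + d)"
proof -
  define S where "S = (if d = centre then {x :: real^3. x $ 1 < 2} else {x. - 2 < x $ 1})"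
  have ne: "centre \<noteq> - centre"
    using centre_nth(1) by (metis vector_uminus_component one_neq_neg_numeral neg_equal_zero zero_neq_numeral)
  have S: "open S" "x \<in> S"
    using assms ne by (auto simp: S_def intro!: open_Collect_less continuous_intros)
  have *: "velocity y = swirl (y + d) \<and> total_pressure y = pressure (y + d)" if "y \<in> S" for y
  proof (cases "d = centre")
    case True
    then have "y + - centre \<in> outside"
      using that by (intro outside_if_far) (auto simp: S_def)
    then show ?thesis
      using True swirl_outside pressure_outside by (simp add: velocity_def total_pressure_def)
  next
    case False
    then have "y + centre \<in> outside"
      using that by (intro outside_if_far) (auto simp: S_def)
    then show ?thesis
      using False assms swirl_outside pressure_outside by (simp add: velocity_def total_pressure_def)
  qed
  then show "velocity x = swirl (x + d)" "total_pressure x = pressure (x + d)"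
    using S(2) by auto
  have "frechet_derivative velocity (at x) = frechet_derivative swirl (at (x + d))"
    "frechet_derivative total_pressure (at x) = frechet_derivative pressure (at (x + d))"
    by (rule frechet_derivative_shift_open[OF S], simp add: *)+
  then show "curl velocity x = curl swirl (x + d)" "grad total_pressure x = grad pressure (x + d)"
    by (simp_all add: curl_def partial_deriv_def grad_def)
qed

lemma velocity_equation: "cross3 (curl velocity x) (velocity x) = grad total_pressure x"
proof -
  obtain d where "d = centre \<and> x $ 1 < 2 \<or> d = - centre \<and> - 2 < x $ 1"
    by (metis linorder_not_less neg_numeral_less_numeral order_less_le_trans)
  from shift_fields[OF this] show ?thesis by (simp add: swirl_equation)
qed

section \<open>Excluding common Euclidean symmetries\<close>

text \<open>Test points are taken at distance 1/4 from the circle. The slope changes sign at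
  \<open>s = 1/20\<close>, so the level has to avoid that value; here \<open>1 / t = 16/3\<close>
  and the second factor is \<open>64/27 * exp (- 16/3)\<close>.\<close>

lemma pressure_slope_nonzero: "pressure_slope (1/16) \<noteq> 0"
  by (simp add: pressure_slope_def flat_def flat_deriv_def pderiv_pCons)

lemma
  assumes "0 < radius y" "tube 1 y = 1/16" "d = centre \<or> d = - centre"
  shows shift_in_solid: "y + d \<in> solid"
    and grad_total_pressure: "grad total_pressure (y + d) = (2 * pressure_slope (1/16)) *\<^sub>R
    vector [(radius y - 1) * (y $ 1 / radius y), (radius y - 1) * (y $ 2 / radius y), y $ 3]"
proof -
  have out: "y \<notin> outside"
    using assms(2) by (simp add: outside_def)
  then show "y + d \<in> solid"
    using tube_shift_less[OF _ assms(3)] by (simp add: solid_def)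
  have "\<bar>y $ 1\<bar> < 2"
    using out outside_if_far[of y] by linarith
  \<comment> \<open>Near \<open>y + d\<close> only the copy centred at \<open>d\<close> is present,
    so translating by \<open>- d\<close> returns to \<open>y\<close>.\<close>
  then have "grad total_pressure (y + d) = grad pressure (y + d + - d)"
    using assms(3) by (intro shift_fields(4)) auto
  then show "grad total_pressure (y + d) = (2 * pressure_slope (1/16)) *\<^sub>R
    vector [(radius y - 1) * (y $ 1 / radius y), (radius y - 1) * (y $ 2 / radius y), y $ 3]"
    using grad_pressure[OF assms(1)] by (simp add: assms(2))
qed

text \<open>Invariance at one test point, divided by the nonzero slope and multiplied by
  \<open>r\<close>, is a linear equation in \<open>a\<close> and \<open>b\<close>. The sign of
  \<open>s\<close> selects the copy.\<close>

lemma invariance_condition: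
  assumes inv: "\<forall>x\<in>solid. lie_derivative (euclidean_generator a b) total_pressure x = 0"
    and r: "radius (vector [x, y, z]) = r" "0 < r" "(r - 1)\<^sup>2 + z\<^sup>2 = 1/16"
    and s: "s = 4 \<or> s = - 4"
  shows "(r - 1) * (x * (a $ 1 + b $ 2 * z - b $ 3 * y) + y * (a $ 2 + b $ 3 * (x + s) - b $ 1 * z)) +
    r * z * (a $ 3 + b $ 1 * y - b $ 2 * (x + s)) = 0"
proof -
  define p :: "real^3" where "p = vector [x, y, z]"
  define d :: "real^3" where "d = axis 1 s"
  have d: "d = centre \<or> d = - centre"
    using s by (auto simp: d_def centre_def vec_eq_iff axis_def)
  have p: "0 < radius p" "tube 1 p = 1/16" "radius p = r"
    using r by (auto simp: p_def tube_def)
  have "lie_derivative (euclidean_generator a b) total_pressure (p + d) = 0"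
    using inv shift_in_solid[OF p(1,2) d] by blast
  then have "(a + cross3 b (p + d)) \<bullet>
     vector [(r - 1) * (x / r), (r - 1) * (y / r), z] = 0"
    using pressure_slope_nonzero
    by (simp add: lie_derivative_def grad_total_pressure[OF p(1,2) d] euclidean_generator_def p(3))
      (simp add: p_def)
  moreover define w where "w = a + cross3 b (p + d)"
  ultimately have "r * (w $ 1 * ((r - 1) * (x / r)) + w $ 2 * ((r - 1) * (y / r)) + w $ 3 * z) = 0"
    by (simp add: inner_vec_def sum_3)
  moreover have "(r - 1) * (x * w $ 1 + y * w $ 2) + r * z * w $ 3 =
      r * (w $ 1 * ((r - 1) * (x / r)) + w $ 2 * ((r - 1) * (y / r)) + w $ 3 * z)"
    using r(2) by (simp add: field_simps)
  moreover have "w $ 1 = a $ 1 + b $ 2 * z - b $ 3 * y" "w $ 2 = a $ 2 + b $ 3 * (x + s) - b $ 1 * z"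
    "w $ 3 = a $ 3 + b $ 1 * y - b $ 2 * (x + s)"
    by (simp_all add: w_def cross3_simps p_def d_def axis_def)
  ultimately show ?thesis by simp
qed

lemma radius_vector: "0 \<le> r \<Longrightarrow> x\<^sup>2 + y\<^sup>2 = r\<^sup>2 \<Longrightarrow> radius (vector [x, y, z]) = r"
  by (simp add: radius_def)

lemma total_pressure_not_invariant: "level_sets_not_euclidean_invariant solid total_pressure"
  unfolding level_sets_not_euclidean_invariant_def
proof (intro allI impI notI)
  fix a b :: "real^3"
  assume ne: "(a, b) \<noteq> (0, 0)"
    and inv: "\<forall>x\<in>solid. lie_derivative (euclidean_generator a b) total_pressure x = 0"
  note cond = invariance_condition[OF inv radius_vector]
  \<comment> \<open>The points used are on the outer equator (\<open>r = 5/4\<close>,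
    \<open>z = 0\<close>) and on the top circle (\<open>r = 1\<close>,
    \<open>z = 1/4\<close>).\<close>
  have "a $ 1 = 0"
    using cond[of "5/4" "5/4" 0 0 4] by (simp add: power2_eq_square)
  \<comment> \<open>One copy yields only \<open>a $ 2 + 4 * b $ 3 = 0\<close>, which allows rotation
    about its own axis; the other copy gives the opposite sign.\<close>
  moreover have "a $ 2 = 0" "b $ 3 = 0"
    using cond[of "5/4" 0 "5/4" 0 4] cond[of "5/4" 0 "5/4" 0 "-4"] by (simp_all add: power2_eq_square)
  moreover have "a $ 3 = 0" "b $ 2 = 0"
    using cond[of 1 1 0 "1/4" 4] cond[of 1 1 0 "1/4" "-4"] by (simp_all add: power2_eq_square)
  moreover have "a $ 3 + b $ 1 - 4 * b $ 2 = 0"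
    using cond[of 1 0 1 "1/4" 4] by (simp add: power2_eq_square)
  ultimately show False
    using ne by (simp add: vec_eq_iff forall_3)
qed

text \<open>The cross product of curl and velocity is the pressure gradient, so a single point with
  nonzero gradient suffices.\<close>

lemma not_everywhere_collinear: "\<not> (\<forall>x\<in>solid. collinear {0, curl velocity x, velocity x})"
proof -
  define p :: "real^3" where "p = vector [5/4, 0, 0]"
  have r: "radius p = 5/4"
    unfolding p_def by (rule radius_vector) (simp_all add: power2_eq_square)
  have p: "0 < radius p" "tube 1 p = 1/16"
    unfolding tube_def r by (simp_all add: p_def power2_eq_square)
  have "grad total_pressure (p + centre) $ 1 \<noteq> 0"
    using pressure_slope_nonzero by (simp add: grad_total_pressure[OF p disjI1[OF refl]] r) (simp add: p_def)
  then have "cross3 (curl velocity (p + centre)) (velocity (p + centre)) \<noteq> 0"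
    by (auto simp: velocity_equation)
  then show ?thesis
    using shift_in_solid[OF p disjI1[OF refl]] by (auto simp: cross_eq_0)
qed

theorem theorem1:
  "\<exists>(\<Omega> :: (real^3) set) (P_b :: real) (u :: real^3 \<Rightarrow> real^3) (P :: real^3 \<Rightarrow> real).
     smooth_bounded_toroidal_domain \<Omega> \<and>
     Cinf_on u \<Omega> \<and> continuous_on (closure \<Omega>) u \<and>
     Cinf_on P \<Omega> \<and> continuous_on (closure \<Omega>) P \<and>
     (\<forall>x\<in>\<Omega>. cross3 (curl u x) (u x) = grad P x) \<and>
     (\<forall>x\<in>frontier \<Omega>. \<forall>n. unit_outward_normal \<Omega> x n \<longrightarrow> u x \<bullet> n = 0) \<and>
     (\<forall>x\<in>frontier \<Omega>. P x = P_b) \<and>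
     \<not> (\<forall>x\<in>\<Omega>. collinear {0, curl u x, u x}) \<and>
     level_sets_not_euclidean_invariant \<Omega> P"
proof (intro exI conjI)
  show "smooth_bounded_toroidal_domain solid" by (rule toroidal_solid)
  show "Cinf_on velocity solid" "Cinf_on total_pressure solid"
    unfolding Cinf_on_def
    using Ck_on_subset[OF Ck_on_velocity] Ck_on_subset[OF Ck_on_total_pressure] by auto
  show "continuous_on (closure solid) velocity" "continuous_on (closure solid) total_pressure"
    using Ck_on_velocity[of 0] Ck_on_total_pressure[of 0] by (auto intro: continuous_on_subset)
  \<comment> \<open>Both fields vanish on the frontier, so tangency holds for every normal and the
    boundary pressure is 0.\<close>
  show "\<forall>x\<in>frontier solid. \<forall>n. unit_outward_normal solid x n \<longrightarrow> velocity x \<bullet> n = 0"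
    "\<forall>x\<in>frontier solid. total_pressure x = 0"
    using outside_if_tube_ge[OF eq_refl[OF frontier_solid[symmetric]]]
    by (simp_all add: velocity_def total_pressure_def swirl_outside pressure_outside)
qed (use velocity_equation not_everywhere_collinear total_pressure_not_invariant in auto)

end
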